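(* Let $f_1,\ldots,f_m:\mathbb{R}^d\to\mathbb{R}$ be convex and continuously differentiable and let $\eta,\eta_g>0$. Consider SCAFFOLD (defined in the context) with $K=1$ gradient step per iteration. If at iteration $r$ the control variates satisfy $\sum_{i=1}^m(\boldsymbol{c}_i^r-\boldsymbol{c}^r)=0$, then $$\boldsymbol{x}_s^{r+1}=\boldsymbol{x}_s^r-\frac{\eta_g\eta}{m}\sum_{i=1}^m\nabla f_i(\boldsymbol{x}_s^r)\qquad\text{and}\qquad \sum_{i=1}^m(\boldsymbol{c}_i^{r+1}-\boldsymbol{c}^{r+1})=0 .$$ Consequently, if the initialisation satisfies $\sum_{i=1}^m(\boldsymbol{c}_i^0-\boldsymbol{c}^0)=0$, then SCAFFOLD with $K=1$ is vanilla gradient descent on $\frac1m\sum_{i=1}^m f_i$ with stepsize $\eta_g\eta$ (which equals $\eta$ when $\eta_g=1$).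
   Context: SCAFFOLD with all clients participating, stepsizes $\eta,\eta_g$ and $K$ local steps: given $\boldsymbol{x}_s^r$, $\boldsymbol{c}^r$, $\{\boldsymbol{c}_i^r\}_{i=1}^m$ in $\mathbb{R}^d$ at iteration $r\ge0$, clients: $\boldsymbol{x}_i^{r,0}=\boldsymbol{x}_s^r$; $\ \boldsymbol{x}_i^{r,k+1}=\boldsymbol{x}_i^{r,k}-\eta(\nabla f_i(\boldsymbol{x}_i^{r,k})-\boldsymbol{c}_i^r+\boldsymbol{c}^r)$ for $k=0,\ldots,K-1$; $\ \boldsymbol{c}_i^{r+1}=\boldsymbol{c}_i^r-\boldsymbol{c}^r+\frac{1}{K\eta}(\boldsymbol{x}_s^r-\boldsymbol{x}_i^{r,K})$; server: $\boldsymbol{x}_s^{r+1}=\boldsymbol{x}_s^r+\eta_g\frac1m\sum_{i=1}^m(\boldsymbol{x}_i^{r,K}-\boldsymbol{x}_s^r)$; $\ \boldsymbol{c}^{r+1}=\boldsymbol{c}^r+\frac1m\sum_{i=1}^m(\boldsymbol{c}_i^{r+1}-\boldsymbol{c}_i^r)$. *)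

theory Defs
  imports "HOL-Analysis.Analysis"
begin

(* Meaningful only where f is differentiable; there the vector is unique. *)
definition gradient :: "('a::real_inner \<Rightarrow> real) \<Rightarrow> 'a \<Rightarrow> 'a" where
  "gradient f x = (THE D. GDERIV f x :> D)"

definition continuously_differentiable :: "('a::real_inner \<Rightarrow> real) \<Rightarrow> bool" where
  "continuously_differentiable f \<longleftrightarrow>
     f differentiable_on UNIV \<and> continuous_on UNIV (gradient f)"

definition is_gradient_descent :: "real \<Rightarrow> ('a::real_inner \<Rightarrow> real) \<Rightarrow> (nat \<Rightarrow> 'a) \<Rightarrow> bool" where
  "is_gradient_descent \<alpha> F x \<longleftrightarrow> (\<forall>r. x (Suc r) = x r - \<alpha> *\<^sub>R gradient F (x r))"

(* The state before an iteration: server iterate x_s, server control variate c,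
   and client control variates c_i. Clients are numbered 1..m; the values of
   client_cv outside {1..m} never enter server quantities. *)
record 'a scaffold_state =
  server_x :: 'a
  server_cv :: 'a
  client_cv :: "nat \<Rightarrow> 'a"

primrec local_iterate ::
  "real \<Rightarrow> (nat \<Rightarrow> 'a::real_inner \<Rightarrow> real) \<Rightarrow> 'a scaffold_state \<Rightarrow> nat \<Rightarrow> nat \<Rightarrow> 'a" where
  "local_iterate \<eta> f s i 0 = server_x s"
| "local_iterate \<eta> f s i (Suc k) =
     local_iterate \<eta> f s i k
       - \<eta> *\<^sub>R (gradient (f i) (local_iterate \<eta> f s i k) - client_cv s i + server_cv s)"

definition client_cv_update ::
  "nat \<Rightarrow> real \<Rightarrow> (nat \<Rightarrow> 'a::real_inner \<Rightarrow> real) \<Rightarrow> 'a scaffold_state \<Rightarrow> nat \<Rightarrow> 'a" where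
  "client_cv_update K \<eta> f s i =
     client_cv s i - server_cv s
       + (1 / (real K * \<eta>)) *\<^sub>R (server_x s - local_iterate \<eta> f s i K)"

definition scaffold_step ::
  "nat \<Rightarrow> nat \<Rightarrow> real \<Rightarrow> real \<Rightarrow> (nat \<Rightarrow> 'a::real_inner \<Rightarrow> real)
     \<Rightarrow> 'a scaffold_state \<Rightarrow> 'a scaffold_state" where
  "scaffold_step m K \<eta> \<eta>\<^sub>g f s =
     \<lparr> server_x = server_x s
         + \<eta>\<^sub>g *\<^sub>R ((1 / real m) *\<^sub>R (\<Sum>i = 1..m. local_iterate \<eta> f s i K - server_x s)),
       server_cv = server_cv s
         + (1 / real m) *\<^sub>R (\<Sum>i = 1..m. client_cv_update K \<eta> f s i - client_cv s i),
       client_cv = client_cv_update K \<eta> f s \<rparr>"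

definition scaffold_run ::
  "nat \<Rightarrow> nat \<Rightarrow> real \<Rightarrow> real \<Rightarrow> (nat \<Rightarrow> 'a::real_inner \<Rightarrow> real)
     \<Rightarrow> (nat \<Rightarrow> 'a scaffold_state) \<Rightarrow> bool" where
  "scaffold_run m K \<eta> \<eta>\<^sub>g f S \<longleftrightarrow> (\<forall>r. S (Suc r) = scaffold_step m K \<eta> \<eta>\<^sub>g f (S r))"

end

theory Submission
  imports Defs
begin

text \<open>
  With one local step, the client update telescopes to
  \<open>c\<^sub>i\<^sup>r\<^sup>+\<^sup>1 = \<nabla>f\<^sub>i(x\<^sub>s\<^sup>r)\<close>, whatever the control variates were. If they
  have mean \<open>c\<^sup>r\<close>, they cancel in the server step, and \<open>c\<^sup>r\<^sup>+\<^sup>1\<close> is the mean of the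
  gradients, so the cancellation persists.
\<close>

text \<open>Makes the \<open>THE\<close> in \<open>gradient\<close> well defined: the Frechet
  derivative is unique, and inner products with all vectors determine a vector.\<close>

lemma GDERIV_unique:
  assumes "GDERIV f x :> D" "GDERIV f x :> E"
  shows "D = E"
proof -
  have "(\<lambda>h. h \<bullet> D) = (\<lambda>h. h \<bullet> E)"
    using assms unfolding gderiv_def by (rule has_derivative_unique)
  then show ?thesis
    unfolding fun_eq_iff vector_eq_ldot .
qed

lemma gradient_eqI: "GDERIV f x :> D \<Longrightarrow> gradient f x = D"
  unfolding gradient_def by (blast intro: GDERIV_unique)

text \<open>Existence is the Riesz representation of the derivative: on a Euclidean space every
  linear functional is the inner product with a fixed vector.\<close>

lemma GDERIV_gradient:
  fixes f :: "'a::euclidean_space \<Rightarrow> real"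
  assumes "f differentiable (at x)"
  shows "GDERIV f x :> gradient f x"
proof -
  obtain f' where f': "(f has_derivative f') (at x)"
    using assms unfolding differentiable_def by blast
  have lin: "linear f'"
    using f' by (rule has_derivative_linear)
  \<comment> \<open>On the reals \<open>\<bullet>\<close> is multiplication, so
    \<open>f' h = f' h \<bullet> 1\<close>; moving \<open>f'\<close> across by its adjoint exhibits
    the representing vector.\<close>
  have "f' = (\<lambda>h. h \<bullet> adjoint f' 1)"
    by (rule ext) (simp add: adjoint_works[OF lin])
  with f' have "GDERIV f x :> adjoint f' 1"
    unfolding gderiv_def by metis
  then show ?thesis
    using gradient_eqI by metis
qed

text \<open>Used to recognise the averaged client gradients as the gradient of the averaged
  objective.\<close>

lemma gradient_scaled_sum:
  fixes f :: "'i \<Rightarrow> 'a::euclidean_space \<Rightarrow> real"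
  assumes "\<And>i. i \<in> A \<Longrightarrow> f i differentiable (at x)"
  shows "gradient (\<lambda>y. a * (\<Sum>i\<in>A. f i y)) x = a *\<^sub>R (\<Sum>i\<in>A. gradient (f i) x)"
proof (rule gradient_eqI)
  have "((\<lambda>y. a * (\<Sum>i\<in>A. f i y)) has_derivative (\<lambda>h. a * (\<Sum>i\<in>A. h \<bullet> gradient (f i) x))) (at x)"
    using GDERIV_gradient[OF assms] unfolding gderiv_def
    by (intro has_derivative_mult_right has_derivative_sum)
  then show "GDERIV (\<lambda>y. a * (\<Sum>i\<in>A. f i y)) x :> a *\<^sub>R (\<Sum>i\<in>A. gradient (f i) x)"
    unfolding gderiv_def by (simp add: inner_sum_right)
qed

text \<open>Dividing the displacement by \<open>\<eta>\<close> returns the gradient plus a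
  correction that cancels \<open>client_cv s i - server_cv s\<close>. For \<open>\<eta> = 0\<close>
  the convention \<open>1 / 0 = 0\<close> would leave that difference instead.\<close>

lemma client_cv_update_one:
  assumes "\<eta> \<noteq> 0"
  shows "client_cv_update 1 \<eta> f s i = gradient (f i) (server_x s)"
  using assms by (simp add: client_cv_update_def)

lemma server_x_scaffold_step_one:
  assumes "(\<Sum>i = 1..m. client_cv s i - server_cv s) = 0"
  shows "server_x (scaffold_step m 1 \<eta> \<eta>\<^sub>g f s) =
    server_x s - (\<eta>\<^sub>g * \<eta> / real m) *\<^sub>R (\<Sum>i = 1..m. gradient (f i) (server_x s))"
proof -
  have "(\<Sum>i = 1..m. local_iterate \<eta> f s i 1 - server_x s) =
      (\<Sum>i = 1..m. \<eta> *\<^sub>R (client_cv s i - server_cv s) - \<eta> *\<^sub>R gradient (f i) (server_x s))"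
    by (rule sum.cong) (simp_all add: algebra_simps)
  \<comment> \<open>With \<open>\<eta>\<close> pulled out of both sums, the correction part is the
    sum that the assumption makes zero.\<close>
  also have "\<dots> = - (\<eta> *\<^sub>R (\<Sum>i = 1..m. gradient (f i) (server_x s)))"
    using assms by (simp only: sum_subtractf flip: scaleR_sum_right) simp
  finally show ?thesis
    by (simp add: scaffold_step_def)
qed

lemma client_cv_sum_scaffold_step_one:
  assumes "m \<ge> 1" "\<eta> \<noteq> 0"
    and "(\<Sum>i = 1..m. client_cv s i - server_cv s) = 0"
  shows "(\<Sum>i = 1..m. client_cv (scaffold_step m 1 \<eta> \<eta>\<^sub>g f s) i
    - server_cv (scaffold_step m 1 \<eta> \<eta>\<^sub>g f s)) = 0"
proof -
  let ?G = "\<Sum>i = 1..m. gradient (f i) (server_x s)"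
  have mean: "(\<Sum>i = 1..m. client_cv s i) = real m *\<^sub>R server_cv s"
    using assms(3) by (simp add: sum_subtractf sum_constant_scaleR)
  have client: "client_cv (scaffold_step m 1 \<eta> \<eta>\<^sub>g f s) i = gradient (f i) (server_x s)" for i
    unfolding scaffold_step_def scaffold_state.simps by (rule client_cv_update_one[OF assms(2)])
  have "server_cv (scaffold_step m 1 \<eta> \<eta>\<^sub>g f s) =
      server_cv s + (1 / real m) *\<^sub>R (?G - real m *\<^sub>R server_cv s)"
    unfolding scaffold_step_def scaffold_state.simps client_cv_update_one[OF assms(2)]
      sum_subtractf mean by (rule refl)
  \<comment> \<open>Since \<open>m \<ge> 1\<close>, the factors \<open>1 / real m\<close> and
    \<open>real m\<close> cancel, and with them both occurrences of the old
    \<open>server_cv s\<close>.\<close>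
  also have "\<dots> = (1 / real m) *\<^sub>R ?G"
    using assms(1) by (simp add: scaleR_diff_right)
  finally have server: "server_cv (scaffold_step m 1 \<eta> \<eta>\<^sub>g f s) = (1 / real m) *\<^sub>R ?G" .
  show ?thesis
    \<comment> \<open>Deviations from a mean sum to zero: \<open>m\<close> copies of the mean add up
      to \<open>?G\<close>.\<close>
    unfolding client server sum_subtractf sum_constant_scaleR using assms(1) by simp
qed

theorem mainTheorem5:
  fixes f :: "nat \<Rightarrow> real ^ 'n \<Rightarrow> real"
    and m :: nat
    and \<eta> \<eta>\<^sub>g :: real
    and S :: "nat \<Rightarrow> (real ^ 'n) scaffold_state"
  assumes "m \<ge> 1"
    and "\<And>i. i \<in> {1..m} \<Longrightarrow> convex_on UNIV (f i)"
    and "\<And>i. i \<in> {1..m} \<Longrightarrow> continuously_differentiable (f i)"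
    and "\<eta> > 0" and "\<eta>\<^sub>g > 0"
    and "scaffold_run m 1 \<eta> \<eta>\<^sub>g f S"
  shows
    "(\<forall>r. (\<Sum>i = 1..m. client_cv (S r) i - server_cv (S r)) = 0 \<longrightarrow>
        server_x (S (Suc r)) =
          server_x (S r)
            - (\<eta>\<^sub>g * \<eta> / real m) *\<^sub>R (\<Sum>i = 1..m. gradient (f i) (server_x (S r)))
        \<and> (\<Sum>i = 1..m. client_cv (S (Suc r)) i - server_cv (S (Suc r))) = 0)
     \<and> ((\<Sum>i = 1..m. client_cv (S 0) i - server_cv (S 0)) = 0 \<longrightarrow>
          is_gradient_descent (\<eta>\<^sub>g * \<eta>) (\<lambda>x. (1 / real m) * (\<Sum>i = 1..m. f i x))
            (\<lambda>r. server_x (S r))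
          \<and> (\<eta>\<^sub>g = 1 \<longrightarrow>
              is_gradient_descent \<eta> (\<lambda>x. (1 / real m) * (\<Sum>i = 1..m. f i x))
                (\<lambda>r. server_x (S r))))"
proof -
  let ?F = "\<lambda>x. (1 / real m) * (\<Sum>i = 1..m. f i x)"
  let ?inv = "\<lambda>r. (\<Sum>i = 1..m. client_cv (S r) i - server_cv (S r)) = 0"
  have run: "S (Suc r) = scaffold_step m 1 \<eta> \<eta>\<^sub>g f (S r)" for r
    using assms(6) by (simp add: scaffold_run_def)
  have step: "server_x (S (Suc r)) = server_x (S r)
      - (\<eta>\<^sub>g * \<eta> / real m) *\<^sub>R (\<Sum>i = 1..m. gradient (f i) (server_x (S r)))"
    if "?inv r" for r
    unfolding run by (rule server_x_scaffold_step_one[OF that])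
  have inv_Suc: "?inv (Suc r)" if "?inv r" for r
    unfolding run using assms(1,4) that by (intro client_cv_sum_scaffold_step_one) auto
  have grad: "gradient ?F x = (1 / real m) *\<^sub>R (\<Sum>i = 1..m. gradient (f i) x)" for x
    using assms(3)
    by (intro gradient_scaled_sum) (auto simp: continuously_differentiable_def differentiable_on_def)
  have descent: "is_gradient_descent (\<eta>\<^sub>g * \<eta>) ?F (\<lambda>r. server_x (S r))" if "?inv 0"
  proof -
    \<comment> \<open>\<open>step\<close> is conditional on the invariant, so the initial condition
      is first carried to every iteration.\<close>
    have "?inv r" for r
      using that inv_Suc by (induction r) blast+
    then show ?thesis
      unfolding is_gradient_descent_def grad by (simp add: step)
  qed
  then have "is_gradient_descent \<eta> ?F (\<lambda>r. server_x (S r))" if "?inv 0" "\<eta>\<^sub>g = 1"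
    using that by simp
  with step inv_Suc descent show ?thesis
    by blast
qed

end
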